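(* Let $p\ge1$, let $0\le r_1\leq r_2\leq\cdots\leq r_p$ be integers and $n\ge 0$ an integer. Write $\mathbf r_p=(r_1,\dots,r_p)$, $|\mathbf r_p|=r_1+\cdots+r_p$ and $|\mathbf r_{p-1}|=r_1+\cdots+r_{p-1}$. Then, as polynomials in $z$, \[ (z+r_p)_{r_1}\cdots(z+r_p)_{r_{p-1}}(z+r_p)^n=\sum_{k=0}^{n+|\mathbf r_{p-1}|}{n+|\mathbf r_p| \brace k+r_p}_{\!\mathbf r_p}(z)_k . \] In particular, for every integer $r\ge0$, \[ (z+r)^n=\sum_{k=0}^{n}{n+r \brace k+r}_{\!r}(z)_k . \]
   Context: $(x)_m=x(x-1)\cdots(x-m+1)$ for $m\ge1$, $(x)_0=1$. For nonnegative integers $r_1,\dots,r_p$ and $N$, let $R_1,\dots,R_p$ be pairwise disjoint subsets of $\{1,\dots,N\}$ with $|R_i|=r_i$; the $(r_1,\dots,r_p)$-Stirling number of the second kind ${N \brace k}_{r_1,\dots,r_p}$ is the number of partitions of $\{1,\dots,N\}$ into $k$ nonempty blocks such that, for each $i$, the elements of $R_i$ lie in distinct blocks (this number does not depend on the choice of the $R_i$, and is $0$ if $N<r_1+\cdots+r_p$). For $p=1$ this is the $r$-Stirling number ${N\brace k}_r$. *)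

theory Defs
  imports
    "HOL-Library.Disjoint_Sets"
    "HOL-Computational_Algebra.Polynomial"
begin

definition falling_factorial :: "'a::comm_ring_1 \<Rightarrow> nat \<Rightarrow> 'a" where
  "falling_factorial x m = (\<Prod>j<m. x - of_nat j)"

text \<open>Families are indexed by \<open>{1..p}\<close>; values of \<open>r\<close> and \<open>R\<close> at other indices are irrelevant.\<close>

definition admissible_family :: "nat \<Rightarrow> nat \<Rightarrow> (nat \<Rightarrow> nat) \<Rightarrow> (nat \<Rightarrow> nat set) \<Rightarrow> bool" where
  "admissible_family N p r R \<longleftrightarrow>
     (\<forall>i\<in>{1..p}. R i \<subseteq> {1..N} \<and> card (R i) = r i) \<and> disjoint_family_on R {1..p}"

definition separating_partitions :: "nat \<Rightarrow> nat \<Rightarrow> nat \<Rightarrow> (nat \<Rightarrow> nat set) \<Rightarrow> nat set set set" where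
  "separating_partitions N k p R =
     {P. partition_on {1..N} P \<and> card P = k \<and>
         (\<forall>i\<in>{1..p}. \<forall>x\<in>R i. \<forall>y\<in>R i. x \<noteq> y \<longrightarrow> \<not> (\<exists>B\<in>P. x \<in> B \<and> y \<in> B))}"

definition consecutive_family :: "(nat \<Rightarrow> nat) \<Rightarrow> nat \<Rightarrow> nat set" where
  "consecutive_family r i = {(\<Sum>j\<in>{1..<i}. r j) <.. (\<Sum>j\<in>{1..i}. r j)}"

text \<open>
  The number \<open>N\<close> brace \<open>k\<close> with index \<open>(r 1, \<dots>, r p)\<close>.  The sets \<open>R i\<close> are taken to be
  consecutive intervals; \<open>multi_stirling_eq_card\<close> below shows that every admissible choice
  gives the same number.
\<close>

definition multi_stirling :: "nat \<Rightarrow> (nat \<Rightarrow> nat) \<Rightarrow> nat \<Rightarrow> nat \<Rightarrow> nat" where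
  "multi_stirling p r N k =
     (if N < (\<Sum>i\<in>{1..p}. r i) then 0
      else card (separating_partitions N k p (consecutive_family r)))"

abbreviation r_stirling :: "nat \<Rightarrow> nat \<Rightarrow> nat \<Rightarrow> nat" where
  "r_stirling r N k \<equiv> multi_stirling 1 (\<lambda>_. r) N k"

lemma admissible_consecutive_family:
  assumes "(\<Sum>i\<in>{1..p}. r i) \<le> N"
  shows "admissible_family N p r (consecutive_family r)"
proof -
  have mono: "(\<Sum>j\<in>{1..i}. r j) \<le> (\<Sum>j\<in>{1..<i'}. r j)" if "i < i'" for i i'
    using that by (intro sum_mono2) auto
  have step: "(\<Sum>j\<in>{1..i}. r j) = (\<Sum>j\<in>{1..<i}. r j) + r i" if "1 \<le> i" for i
    using that by (simp add: sum.last_plus add.commute)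
  have top: "(\<Sum>j\<in>{1..i}. r j) \<le> N" if "i \<le> p" for i
  proof -
    have "(\<Sum>j\<in>{1..i}. r j) \<le> (\<Sum>j\<in>{1..p}. r j)"
      using that by (intro sum_mono2) auto
    with assms show ?thesis by simp
  qed
  have disj: "consecutive_family r i \<inter> consecutive_family r i' = {}" if "i < i'" for i i'
    using mono[OF that] unfolding consecutive_family_def by auto
  have "disjoint_family_on (consecutive_family r) {1..p}"
    unfolding disjoint_family_on_def
  proof (intro ballI impI)
    fix i i' :: nat assume "i \<noteq> i'"
    then consider "i < i'" | "i' < i" by linarith
    then show "consecutive_family r i \<inter> consecutive_family r i' = {}"
      using disj[of i i'] disj[of i' i] by cases blast+
  qed
  moreover have "consecutive_family r i \<subseteq> {1..N} \<and> card (consecutive_family r i) = r i"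
    if "i \<in> {1..p}" for i
  proof
    show "consecutive_family r i \<subseteq> {1..N}"
      using that top[of i] unfolding consecutive_family_def by fastforce
    show "card (consecutive_family r i) = r i"
      using that step[of i] unfolding consecutive_family_def by simp
  qed
  ultimately show ?thesis
    unfolding admissible_family_def by blast
qed

lemma disjoint_families_bij:
  assumes "finite I" "disjoint_family_on R I" "disjoint_family_on S I"
    and "\<And>i. i \<in> I \<Longrightarrow> finite (R i) \<and> finite (S i) \<and> card (R i) = card (S i)"
  shows "\<exists>g. bij_betw g (\<Union>i\<in>I. R i) (\<Union>i\<in>I. S i) \<and> (\<forall>i\<in>I. g ` R i = S i)"
  using assms
proof (induction I rule: finite_induct)
  case empty
  then show ?case by (auto simp: bij_betw_def)
next
  case (insert j I)
  have "disjoint_family_on R I" "disjoint_family_on S I"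
    using disjoint_family_on_mono[OF subset_insertI] insert.prems(1,2) by metis+
  then obtain g where
    g: "bij_betw g (\<Union>i\<in>I. R i) (\<Union>i\<in>I. S i)" "\<forall>i\<in>I. g ` R i = S i"
    using insert.IH insert.prems(3) by (meson insertI2)
  obtain h where h: "bij_betw h (R j) (S j)"
    using insert.prems(3)[OF insertI1] finite_same_card_bij by metis
  have dR: "R j \<inter> (\<Union>i\<in>I. R i) = {}" and dS: "S j \<inter> (\<Union>i\<in>I. S i) = {}"
    using insert.hyps(2) disjoint_family_onD[OF insert.prems(1)]
      disjoint_family_onD[OF insert.prems(2)] by fastforce+
  define f where "f x = (if x \<in> R j then h x else g x)" for x
  have fj: "bij_betw f (R j) (S j)"
    using h by (subst bij_betw_cong[of _ _ h]) (auto simp: f_def)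
  have fI: "bij_betw f (\<Union>i\<in>I. R i) (\<Union>i\<in>I. S i)"
    using g(1) dR by (subst bij_betw_cong[of _ _ g]) (auto simp: f_def)
  have "bij_betw f (\<Union>i\<in>insert j I. R i) (\<Union>i\<in>insert j I. S i)"
    using bij_betw_combine[OF fj fI dS] by simp
  moreover have "f ` R i = S i" if "i \<in> insert j I" for i
  proof (cases "i = j")
    case True
    then show ?thesis using fj by (simp add: bij_betw_def)
  next
    case False
    with that have "i \<in> I" by simp
    then have "f ` R i = g ` R i"
      using dR by (intro image_cong) (auto simp: f_def)
    with g(2) \<open>i \<in> I\<close> show ?thesis by simp
  qed
  ultimately show ?case by blast
qed

lemma finite_separating_partitions: "finite (separating_partitions N k p R)"
proof (rule finite_subset)
  show "separating_partitions N k p R \<subseteq> Pow (Pow {1..N})"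
    unfolding separating_partitions_def partition_on_def by blast
qed simp

lemma card_separating_partitions_le:
  assumes R: "admissible_family N p r R" and S: "admissible_family N p r S"
  shows "card (separating_partitions N k p R) \<le> card (separating_partitions N k p S)"
proof -
  let ?U = "\<Union>i\<in>{1..p}. R i" and ?V = "\<Union>i\<in>{1..p}. S i"
  have fin: "finite (R i) \<and> finite (S i) \<and> card (R i) = card (S i)" if "i \<in> {1..p}" for i
    using R S that finite_subset[OF _ finite_atLeastAtMost, of _ 1 N]
    unfolding admissible_family_def by simp
  obtain g where g: "bij_betw g ?U ?V" "\<forall>i\<in>{1..p}. g ` R i = S i"
    using disjoint_families_bij[of "{1..p}" R S] R S fin unfolding admissible_family_def by auto
  have sub: "?U \<subseteq> {1..N}" "?V \<subseteq> {1..N}"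
    using R S unfolding admissible_family_def by auto
  have "card ?U = card ?V"
    using g(1) by (rule bij_betw_same_card)
  then have "card ({1..N} - ?U) = card ({1..N} - ?V)"
    using card_Diff_subset[OF finite_subset[OF sub(1) finite_atLeastAtMost] sub(1)]
      card_Diff_subset[OF finite_subset[OF sub(2) finite_atLeastAtMost] sub(2)] by simp
  then obtain h where h: "bij_betw h ({1..N} - ?U) ({1..N} - ?V)"
    using finite_same_card_bij by blast
  define f where "f x = (if x \<in> ?U then g x else h x)" for x
  have fU: "bij_betw f ?U ?V"
    using g(1) by (subst bij_betw_cong[of _ _ g]) (auto simp: f_def)
  have fC: "bij_betw f ({1..N} - ?U) ({1..N} - ?V)"
    using h by (subst bij_betw_cong[of _ _ h]) (auto simp: f_def)
  have "bij_betw f (?U \<union> ({1..N} - ?U)) (?V \<union> ({1..N} - ?V))"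
    by (rule bij_betw_combine[OF fU fC]) blast
  moreover have "?U \<union> ({1..N} - ?U) = {1..N}" "?V \<union> ({1..N} - ?V) = {1..N}"
    using sub by blast+
  ultimately have f: "bij_betw f {1..N} {1..N}"
    by simp
  then have inj: "inj_on f {1..N}" and img: "f ` {1..N} = {1..N}"
    by (auto simp: bij_betw_def)
  have fR: "f ` R i = S i" if "i \<in> {1..p}" for i
  proof -
    have "f ` R i = g ` R i"
      using that by (intro image_cong) (auto simp: f_def)
    with g(2) that show ?thesis by simp
  qed
  have injPow: "inj_on ((`) f) (Pow {1..N})"
    using inj by (rule inj_on_image_Pow)
  have injPP: "inj_on ((`) ((`) f)) (Pow (Pow {1..N}))"
    using injPow by (rule inj_on_image_Pow)
  show ?thesis
  proof (rule card_inj_on_le[where f = "(`) ((`) f)"])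
    show "inj_on ((`) ((`) f)) (separating_partitions N k p R)"
      by (rule inj_on_subset[OF injPP])
        (auto simp: separating_partitions_def partition_on_def)
    show "finite (separating_partitions N k p S)"
      by (rule finite_separating_partitions)
    show "(`) ((`) f) ` separating_partitions N k p R \<subseteq> separating_partitions N k p S"
    proof (rule image_subsetI)
      fix P assume P: "P \<in> separating_partitions N k p R"
      then have part: "partition_on {1..N} P" and cP: "card P = k"
        and sep: "\<And>i x y B. i \<in> {1..p} \<Longrightarrow> x \<in> R i \<Longrightarrow> y \<in> R i \<Longrightarrow> B \<in> P
                    \<Longrightarrow> x \<in> B \<Longrightarrow> y \<in> B \<Longrightarrow> x = y"
        unfolding separating_partitions_def by blast+
      have PP: "P \<subseteq> Pow {1..N}" and ne: "{} \<notin> P"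
        using part by (auto simp: partition_on_def)
      have "partition_on (f ` {1..N}) ((`) f ` P - {{}})"
        using part inj by (rule partition_on_inj_image)
      moreover have "(`) f ` P - {{}} = (`) f ` P"
        using ne by auto
      ultimately have part': "partition_on {1..N} ((`) f ` P)"
        using img by simp
      have card': "card ((`) f ` P) = k"
        using cP card_image[OF inj_on_subset[OF injPow PP]] by simp
      have sep': "x = y"
        if h: "i \<in> {1..p}" "x \<in> S i" "y \<in> S i" "C \<in> (`) f ` P" "x \<in> C" "y \<in> C" for i x y C
      proof -
        obtain B where B: "B \<in> P" "C = f ` B" using h(4) by blast
        obtain a b where ab: "a \<in> R i" "x = f a" "b \<in> R i" "y = f b"
          using h(2,3) fR[OF h(1)] by blast
        have sub': "R i \<subseteq> {1..N}" "B \<subseteq> {1..N}"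
          using R h(1) B(1) PP unfolding admissible_family_def by auto
        have "f c \<in> f ` B \<longleftrightarrow> c \<in> B" if "c \<in> R i" for c
          using inj_on_image_mem_iff[OF inj _ sub'(2)] that sub'(1) by blast
        then have "a \<in> B" "b \<in> B"
          using h(5,6) unfolding B(2) ab(2,4) using ab(1,3) by simp_all
        then show ?thesis
          using sep[OF h(1) ab(1) ab(3) B(1)] ab by simp
      qed
      show "(`) f ` P \<in> separating_partitions N k p S"
        unfolding separating_partitions_def using part' card' sep' by blast
    qed
  qed
qed

lemma multi_stirling_eq_card:
  assumes "admissible_family N p r R"
  shows "multi_stirling p r N k = card (separating_partitions N k p R)"
proof -
  have RN: "R i \<subseteq> {1..N}" and Rr: "card (R i) = r i" if "i \<in> {1..p}" for i
    using assms that unfolding admissible_family_def by blast+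
  have disj: "\<forall>i\<in>{1..p}. \<forall>j\<in>{1..p}. i \<noteq> j \<longrightarrow> R i \<inter> R j = {}"
    using assms unfolding admissible_family_def disjoint_family_on_def by blast
  have fin: "\<forall>i\<in>{1..p}. finite (R i)"
    using RN finite_subset[OF _ finite_atLeastAtMost] by blast
  have "(\<Sum>i\<in>{1..p}. r i) = (\<Sum>i\<in>{1..p}. card (R i))"
    by (rule sum.cong[OF refl]) (rule Rr[symmetric])
  also have "\<dots> = card (\<Union>i\<in>{1..p}. R i)"
    by (rule card_UN_disjoint[OF finite_atLeastAtMost fin disj, symmetric])
  also have "\<dots> \<le> card {1..N}"
    by (rule card_mono[OF finite_atLeastAtMost UN_least[OF RN]])
  finally have le: "(\<Sum>i\<in>{1..p}. r i) \<le> N" by simp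
  have "card (separating_partitions N k p (consecutive_family r)) =
        card (separating_partitions N k p R)"
    by (intro le_antisym card_separating_partitions_le[where r = r]
        admissible_consecutive_family le assms)
  with le show ?thesis
    unfolding multi_stirling_def by simp
qed

end

theory Submission
  imports Defs
begin

text \<open>
  Regard the partitions as partitions into independent sets of the graph whose edges join distinct
  elements of the same \<open>R i\<close>, and weight a partition with \<open>k\<close> blocks by \<open>(z)\<^sub>k\<^sub>-\<^sub>r\<close> where \<open>r = r p\<close>.
  On \<open>R p\<close> alone the total weight is \<open>1\<close>. If a new vertex is adjacent to exactly \<open>c\<close> old vertices,
  and these form a clique, it may be put into \<open>k - c\<close> of the \<open>k\<close> old blocks or form a block of its
  own; as \<open>(k - c) (z)\<^sub>k\<^sub>-\<^sub>r + (z)\<^sub>k\<^sub>-\<^sub>r\<^sub>+\<^sub>1 = (z + r - c) (z)\<^sub>k\<^sub>-\<^sub>r\<close>, the total weight is multiplied by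
  \<open>z + r - c\<close>. Adding the other vertices one at a time yields the product.
\<close>

lemma falling_factorial_Suc:
  "falling_factorial x (Suc m) = falling_factorial x m * (x - of_nat m)"
  by (simp add: falling_factorial_def)

section \<open>Partitions of a vertex set into independent sets\<close>

locale conflict_graph =
  fixes E :: "'v \<Rightarrow> 'v \<Rightarrow> bool"
  assumes sym: "E x y \<Longrightarrow> E y x" and irrefl: "\<not> E x x"
begin

definition independent_partitions :: "'v set \<Rightarrow> 'v set set set" where
  "independent_partitions A = {P. partition_on A P \<and> (\<forall>B\<in>P. \<forall>x\<in>B. \<forall>y\<in>B. \<not> E x y)}"

text \<open>The subtraction of naturals is truncated. It is exact when \<open>A\<close> is finite
  and contains a clique of \<open>r\<close> vertices, since these occupy \<open>r\<close> different
  blocks.\<close>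

definition weight :: "'a::comm_ring_1 \<Rightarrow> nat \<Rightarrow> 'v set \<Rightarrow> 'a" where
  "weight z r A = (\<Sum>P\<in>independent_partitions A. falling_factorial z (card P - r))"

lemma independent_partitionsD:
  assumes "P \<in> independent_partitions A"
  shows "partition_on A P" "B \<in> P \<Longrightarrow> x \<in> B \<Longrightarrow> y \<in> B \<Longrightarrow> \<not> E x y"
  using assms by (auto simp: independent_partitions_def)

lemma finite_independent_partitions:
  assumes "finite A"
  shows "finite (independent_partitions A)"
proof (rule finite_subset)
  show "independent_partitions A \<subseteq> Pow (Pow A)"
    unfolding independent_partitions_def partition_on_def by blast
qed (simp add: assms)

section \<open>Blocks met and avoided by a clique\<close>

text \<open>Each vertex of \<open>C\<close> lies in exactly one block, and adjacent vertices never
  share a block. So sending a vertex to its block is a bijection from \<open>C\<close> onto the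
  blocks that meet \<open>C\<close>.\<close>

lemma card_blocks_meeting_clique:
  assumes P: "P \<in> independent_partitions A" and C: "C \<subseteq> A" "pairwise E C"
  shows "card {B \<in> P. B \<inter> C \<noteq> {}} = card C"
proof -
  note part = independent_partitionsD(1)[OF P]
  have ex: "\<exists>B\<in>P. x \<in> B" if "x \<in> C" for x
    using that C(1) partition_onD1[OF part] by blast
  define f where "f x = (SOME B. B \<in> P \<and> x \<in> B)" for x
  have f: "f x \<in> P \<and> x \<in> f x" if "x \<in> C" for x
    unfolding f_def by (rule someI_ex[of "\<lambda>B. B \<in> P \<and> x \<in> B"]) (use ex[OF that] in blast)
  have f_eq: "f x = B" if "x \<in> C" "B \<in> P" "x \<in> B" for x B
    using f[OF that(1)] that partition_onD2[OF part] by (auto simp: disjoint_def)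
  have "inj_on f C"
  proof (rule inj_onI, rule ccontr)
    fix x y assume xy: "x \<in> C" "y \<in> C" "f x = f y" "x \<noteq> y"
    then have "E x y" using C(2) by (simp add: pairwise_def)
    then show False
      using independent_partitionsD(2)[OF P, of "f x" x y] f[OF xy(1)] f[OF xy(2)] xy(3) by simp
  qed
  moreover have "f ` C = {B \<in> P. B \<inter> C \<noteq> {}}"
    using f f_eq by blast
  ultimately show ?thesis
    by (metis card_image)
qed

lemma card_clique_le_card_partition:
  assumes "P \<in> independent_partitions A" "C \<subseteq> A" "pairwise E C" "finite A"
  shows "card C \<le> card P"
proof -
  have "finite P"
    using independent_partitionsD(1)[OF assms(1)] assms(4) by (rule finite_elements[rotated])
  then have "card {B \<in> P. B \<inter> C \<noteq> {}} \<le> card P"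
    by (intro card_mono) auto
  then show ?thesis
    using card_blocks_meeting_clique[OF assms(1-3)] by simp
qed

lemma card_blocks_avoiding_clique:
  assumes "P \<in> independent_partitions A" "C \<subseteq> A" "pairwise E C" "finite A"
  shows "card {B \<in> P. B \<inter> C = {}} = card P - card C"
proof -
  have "finite P"
    using independent_partitionsD(1)[OF assms(1)] assms(4) by (rule finite_elements[rotated])
  then have "card (P - {B \<in> P. B \<inter> C \<noteq> {}}) = card P - card {B \<in> P. B \<inter> C \<noteq> {}}"
    by (intro card_Diff_subset) auto
  moreover have "P - {B \<in> P. B \<inter> C \<noteq> {}} = {B \<in> P. B \<inter> C = {}}"
    by blast
  ultimately show ?thesis
    using card_blocks_meeting_clique[OF assms(1-3)] by simp
qed

section \<open>Effect of adding one vertex\<close>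

text \<open>The summand \<open>B = {}\<close> accounts for the partitions in which \<open>a\<close> is a singleton block.\<close>

lemma sum_independent_partitions_insert:
  fixes g :: "'v set set \<Rightarrow> 'b::comm_monoid_add"
  assumes A: "finite A" "a \<notin> A"
  defines "C \<equiv> {x \<in> A. E a x}"
  shows "(\<Sum>P\<in>independent_partitions (insert a A). g P) =
    (\<Sum>P\<in>independent_partitions A. \<Sum>B\<in>insert {} {B \<in> P. B \<inter> C = {}}.
       g (insert (insert a B) (P - {B})))"
proof -
  \<comment> \<open>\<open>?X P'\<close> is the block of \<open>a\<close>, written as a union to
    avoid a choice. \<open>?i\<close> deletes \<open>a\<close>, drops its block if that becomes
    empty, and records the remainder \<open>B\<close>; \<open>?j\<close> puts \<open>a\<close> back
    into \<open>B\<close>. The two maps are mutually inverse.\<close>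
  let ?X = "\<lambda>P'. \<Union>{B \<in> P'. a \<in> B}"
  let ?S = "SIGMA P:independent_partitions A. insert {} {B \<in> P. B \<inter> C = {}}"
  let ?j = "\<lambda>(P, B). insert (insert a B) (P - {B})"
  let ?i = "\<lambda>P'. ((P' - {?X P'}) \<union> ({?X P' - {a}} - {{}}), ?X P' - {a})"
  have fwd: "?i P' \<in> ?S \<and> ?j (?i P') = P'" if P': "P' \<in> independent_partitions (insert a A)" for P'
  proof -
    note part = independent_partitionsD(1)[OF P']
    obtain B where B: "B \<in> P'" "a \<in> B"
      using partition_onD1[OF part] by blast
    have disj: "D = D'" if "D \<in> P'" "D' \<in> P'" "x \<in> D" "x \<in> D'" for D D' x
      using that partition_onD2[OF part] by (auto simp: disjoint_def)
    have X: "?X P' = B"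
      using B disj by blast
    have ne: "{} \<notin> P'" and un: "\<Union>P' = insert a A"
      using part by (auto simp: partition_on_def)
    \<comment> \<open>If the remainder were a block, it would be nonempty and overlap
      \<open>B\<close>, hence equal \<open>B\<close>, which contains \<open>a\<close>. So when
      \<open>?j\<close> removes the remainder, exactly the other old blocks are left.\<close>
    have notin: "B - {a} \<notin> P'"
      using disj[of "B - {a}" B] ne B by (metis Diff_iff equals0I singletonI)
    have "partition_on A (P' - {B} \<union> ({B - {a}} - {{}}))"
    proof (rule partition_onI)
      show "\<Union>(P' - {B} \<union> ({B - {a}} - {{}})) = A"
      proof (rule set_eqI, rule iffI)
        fix x assume "x \<in> \<Union>(P' - {B} \<union> ({B - {a}} - {{}}))"
        then consider D where "D \<in> P'" "D \<noteq> B" "x \<in> D" | "x \<in> B" "x \<noteq> a" by blast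
        then show "x \<in> A"
        proof cases
          case (1 D)
          then have "x \<noteq> a" using disj[of D B a] B by blast
          with 1 un show ?thesis by blast
        next
          case 2
          with B un show ?thesis by blast
        qed
      next
        fix x assume x: "x \<in> A"
        then obtain D where "D \<in> P'" "x \<in> D" using un by blast
        then show "x \<in> \<Union>(P' - {B} \<union> ({B - {a}} - {{}}))"
          using x A(2) by (cases "D = B") auto
      qed
      show "disjnt p q" if "p \<in> P' - {B} \<union> ({B - {a}} - {{}})" "q \<in> P' - {B} \<union> ({B - {a}} - {{}})"
        "p \<noteq> q" for p q
        using that disj B unfolding disjnt_def by blast
    qed (use ne in auto)
    then have "P' - {B} \<union> ({B - {a}} - {{}}) \<in> independent_partitions A"
      using independent_partitionsD(2)[OF P'] B by (auto simp: independent_partitions_def)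
    moreover have "(B - {a}) \<inter> C = {}"
      using independent_partitionsD(2)[OF P' B(1) B(2)] by (auto simp: C_def)
    moreover have "insert (insert a (B - {a})) ((P' - {B} \<union> ({B - {a}} - {{}})) - {B - {a}}) = P'"
      using B notin by (auto simp: insert_absorb)
    ultimately show ?thesis unfolding X by auto
  qed
  have bwd: "?j Q \<in> independent_partitions (insert a A) \<and> ?i (?j Q) = Q" if Q: "Q \<in> ?S" for Q
  proof -
    obtain P B where PB: "Q = (P, B)" "P \<in> independent_partitions A"
      "B = {} \<or> B \<in> P \<and> B \<inter> C = {}"
      using Q by blast
    note part = independent_partitionsD(1)[OF PB(2)]
    have ne: "{} \<notin> P" and un: "\<Union>P = A"
      using part by (auto simp: partition_on_def)
    have disj: "D = D'" if "D \<in> P" "D' \<in> P" "x \<in> D" "x \<in> D'" for D D' x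
      using that partition_onD2[OF part] by (auto simp: disjoint_def)
    have na: "a \<notin> D" if "D \<in> P" for D
      using that un A(2) by blast
    have naB: "a \<notin> B"
      using PB(3) na by blast
    have "partition_on (insert a A) (insert (insert a B) (P - {B}))"
    proof (rule partition_onI)
      show "\<Union>(insert (insert a B) (P - {B})) = insert a A"
        using un PB(3) by blast
      show "disjnt p q" if "p \<in> insert (insert a B) (P - {B})" "q \<in> insert (insert a B) (P - {B})"
        "p \<noteq> q" for p q
        using that disj PB(3) na unfolding disjnt_def by blast
    qed (use ne in auto)
    moreover have "\<not> E x y" if "D \<in> insert (insert a B) (P - {B})" "x \<in> D" "y \<in> D" for D x y
    proof (cases "D \<in> P")
      case True
      then show ?thesis using independent_partitionsD(2)[OF PB(2)] that by blast
    next
      \<comment> \<open>Here \<open>D\<close> is \<open>insert a B\<close>. As \<open>B\<close> is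
        empty or avoids \<open>C\<close>, it contains no neighbour of \<open>a\<close>.\<close>
      case False
      have "\<not> E a u" if "u \<in> B" for u
        using that PB(3) un by (auto simp: C_def)
      moreover have "\<not> E u v" if "u \<in> B" "v \<in> B" for u v
        using that PB(3) independent_partitionsD(2)[OF PB(2)] by blast
      ultimately show ?thesis
        using False that irrefl sym by blast
    qed
    ultimately have "?j Q \<in> independent_partitions (insert a A)"
      unfolding PB(1) independent_partitions_def by auto
    moreover have X: "?X (insert (insert a B) (P - {B})) = insert a B"
      using na by auto
    have "insert a B \<notin> P"
      using na by blast
    then have "?i (?j Q) = Q"
      unfolding PB(1) prod.case X using PB(3) naB ne by auto
    ultimately show ?thesis by blast
  qed
  have "(\<Sum>P\<in>independent_partitions (insert a A). g P) = (\<Sum>Q\<in>?S. g (?j Q))"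
    using fwd bwd by (intro sum.reindex_bij_witness[where i = ?j and j = ?i]) auto
  also have "\<dots> = (\<Sum>P\<in>independent_partitions A. \<Sum>B\<in>insert {} {B \<in> P. B \<inter> C = {}}.
       g (insert (insert a B) (P - {B})))"
  proof (subst sum.Sigma)
    show "\<forall>P\<in>independent_partitions A. finite (insert {} {B \<in> P. B \<inter> C = {}})"
      using finite_elements[OF A(1) independent_partitionsD(1)] by simp
  qed (use finite_independent_partitions[OF A(1)] in \<open>auto simp: case_prod_beta\<close>)
  finally show ?thesis .
qed

text \<open>The recurrence holds for each \<open>P\<close> separately. The clique \<open>K\<close>
  ensures \<open>r \<le> card P\<close>, and the neighbours of \<open>a\<close>, being a clique,
  rule out exactly \<open>c\<close> blocks.\<close>

lemma weight_insert:
  assumes A: "finite A" "a \<notin> A"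
    and K: "K \<subseteq> A" "pairwise E K" "card K = r"
    and C: "pairwise E {x \<in> A. E a x}" "card {x \<in> A. E a x} = c"
  shows "weight z r (insert a A) = weight z r A * (z + of_nat r - of_nat c)"
proof -
  let ?C = "{x \<in> A. E a x}"
  have "(\<Sum>B\<in>insert {} {B \<in> P. B \<inter> ?C = {}}.
          falling_factorial z (card (insert (insert a B) (P - {B})) - r)) =
        falling_factorial z (card P - r) * (z + of_nat r - of_nat c)"
    if P: "P \<in> independent_partitions A" for P
  proof -
    note part = independent_partitionsD(1)[OF P]
    have fin: "finite P" using A(1) part by (rule finite_elements)
    have ne: "{} \<notin> P" using part by (auto simp: partition_on_def)
    have na: "insert a B \<notin> P" for B
      using partition_onD1[OF part] A(2) by blast
    have rP: "r \<le> card P"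
      using card_clique_le_card_partition[OF P K(1,2) A(1)] K(3) by simp
    have cP: "c \<le> card P"
      using card_clique_le_card_partition[OF P _ C(1) A(1)] C(2) by auto
    have avoid: "card {B \<in> P. B \<inter> ?C = {}} = card P - c"
      using card_blocks_avoiding_clique[OF P _ C(1) A(1)] C(2) by auto
    have join: "card (insert (insert a B) (P - {B})) = card P" if "B \<in> P" for B
      using that fin na[of B] card_Suc_Diff1[OF fin that] by simp
    \<comment> \<open>Only the choice \<open>B = {}\<close> increases the number of blocks; every
      other choice enlarges an existing block.\<close>
    have "(\<Sum>B\<in>insert {} {B \<in> P. B \<inter> ?C = {}}.
          falling_factorial z (card (insert (insert a B) (P - {B})) - r)) =
      falling_factorial z (Suc (card P) - r) +
      (\<Sum>B\<in>{B \<in> P. B \<inter> ?C = {}}. falling_factorial z (card P - r))"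
      using fin ne na[of "{}"] join by (simp add: sum.insert)
    also have "\<dots> = falling_factorial z (card P - r) * (z - of_nat (card P - r)) +
        of_nat (card P - c) * falling_factorial z (card P - r)"
      using rP by (simp add: avoid Suc_diff_le falling_factorial_Suc)
    \<comment> \<open>With \<open>k = card P\<close>, both differences are exact and
      \<open>k\<close> cancels: \<open>z - (k - r) + (k - c) = z + r - c\<close>.\<close>
    also have "\<dots> = falling_factorial z (card P - r) * (z + of_nat r - of_nat c)"
      using rP cP by (simp add: of_nat_diff algebra_simps)
    finally show ?thesis .
  qed
  then show ?thesis
    unfolding weight_def sum_independent_partitions_insert[OF A] sum_distrib_right
    by (intro sum.cong) auto
qed

section \<open>Building a graph from a clique\<close>

text \<open>A clique splits into independent sets only as singletons, so the sum has one term, an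
  empty product.\<close>

lemma weight_clique:
  assumes "finite K" "pairwise E K"
  shows "weight z (card K) K = 1"
proof -
  have "independent_partitions K = {(\<lambda>x. {x}) ` K}"
  proof (rule equalityI; rule subsetI)
    fix P assume P: "P \<in> independent_partitions K"
    note part = independent_partitionsD(1)[OF P]
    have single: "B = {x}" if "B \<in> P" "x \<in> B" for B x
      using that independent_partitionsD(2)[OF P] partition_onD1[OF part] assms(2)
      unfolding pairwise_def by blast
    moreover have "\<exists>x. x \<in> B" if "B \<in> P" for B
      using that partition_onD3[OF part] by (metis equals0I)
    ultimately have "P = (\<lambda>x. {x}) ` K"
      using partition_onD1[OF part] by blast
    then show "P \<in> {(\<lambda>x. {x}) ` K}" by simp
  next
    fix P assume "P \<in> {(\<lambda>x. {x}) ` K}"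
    then show "P \<in> independent_partitions K"
      using irrefl by (auto simp: independent_partitions_def partition_on_def disjoint_def)
  qed
  moreover have "card ((\<lambda>x. {x}) ` K) = card K"
    by (simp add: card_image)
  ultimately show ?thesis
    by (simp add: weight_def falling_factorial_def)
qed

text \<open>When the vertices of \<open>D\<close> arrive one at a time, the neighbours of each
  newcomer are exactly the members of \<open>D\<close> already present. Thus \<open>c\<close> runs
  through \<open>0, 1, ..., card D - 1\<close>, and the factors form a falling factorial.\<close>

lemma weight_Un_clique:
  assumes A: "finite A" and K: "K \<subseteq> A" "pairwise E K" "card K = r"
    and D: "finite D" "D \<inter> A = {}" "pairwise E D" "\<And>x y. x \<in> D \<Longrightarrow> y \<in> A \<Longrightarrow> \<not> E x y"
  shows "weight z r (A \<union> D) = weight z r A * falling_factorial (z + of_nat r) (card D)"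
  using D
proof (induction D rule: finite_induct)
  case empty
  then show ?case by (simp add: falling_factorial_def)
next
  case (insert a D)
  have "E a x" if "x \<in> D" for x
    using that insert.hyps(2) insert.prems(2) by (auto simp: pairwise_insert)
  then have nb: "{x \<in> A \<union> D. E a x} = D"
    using insert.prems(3) by blast
  have cl: "pairwise E D"
    using insert.prems(2) by (simp add: pairwise_insert)
  have "weight z r (A \<union> insert a D) = weight z r (insert a (A \<union> D))"
    by simp
  also have "\<dots> = weight z r (A \<union> D) * (z + of_nat r - of_nat (card D))"
    using A K insert.hyps insert.prems(1) cl
    by (intro weight_insert[where K = K]; (subst nb)?) auto
  also have "weight z r (A \<union> D) = weight z r A * falling_factorial (z + of_nat r) (card D)"
    using insert.prems cl by (intro insert.IH) auto
  finally show ?case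
    using insert.hyps by (simp add: falling_factorial_Suc mult.assoc)
qed

text \<open>Every newcomer has \<open>c = 0\<close>, so each contributes the same factor.\<close>

lemma weight_Un_isolated:
  assumes A: "finite A" and K: "K \<subseteq> A" "pairwise E K" "card K = r"
    and D: "finite D" "D \<inter> A = {}" "\<And>x y. x \<in> D \<Longrightarrow> \<not> E x y"
  shows "weight z r (A \<union> D) = weight z r A * (z + of_nat r) ^ card D"
  using D
proof (induction D rule: finite_induct)
  case empty
  then show ?case by simp
next
  case (insert a D)
  have nb: "{x \<in> A \<union> D. E a x} = {}"
    using insert.prems(2) by blast
  have "weight z r (A \<union> insert a D) = weight z r (insert a (A \<union> D))"
    by simp
  also have "\<dots> = weight z r (A \<union> D) * (z + of_nat r - of_nat 0)"
    using A K insert.hyps insert.prems(1)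
    by (intro weight_insert[where K = K]; (subst nb)?) auto
  also have "weight z r (A \<union> D) = weight z r A * (z + of_nat r) ^ card D"
    using insert.prems by (intro insert.IH) auto
  finally show ?case
    using insert.hyps by (simp add: mult_ac)
qed

text \<open>The cliques \<open>R i\<close> are added whole, one after another. \<open>K\<close>
  stays inside the growing set, so the shift \<open>r\<close> is the same throughout.\<close>

lemma weight_Un_cliques:
  assumes A: "finite A" and K: "K \<subseteq> A" "pairwise E K" "card K = r"
    and I: "finite I" "disjoint_family_on R I"
      "\<And>i. i \<in> I \<Longrightarrow> finite (R i) \<and> R i \<inter> A = {} \<and> pairwise E (R i)"
      "\<And>i x y. i \<in> I \<Longrightarrow> x \<in> R i \<Longrightarrow> y \<notin> R i \<Longrightarrow> \<not> E x y"
  shows "weight z r (A \<union> (\<Union>i\<in>I. R i)) =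
    weight z r A * (\<Prod>i\<in>I. falling_factorial (z + of_nat r) (card (R i)))"
  using I
proof (induction I rule: finite_induct)
  case empty
  then show ?case by simp
next
  case (insert j I)
  have disj: "R j \<inter> (A \<union> (\<Union>i\<in>I. R i)) = {}"
    using insert.hyps(2) insert.prems(2)[of j] disjoint_family_onD[OF insert.prems(1), of j]
    by fastforce
  have "weight z r (A \<union> (\<Union>i\<in>insert j I. R i)) = weight z r ((A \<union> (\<Union>i\<in>I. R i)) \<union> R j)"
    by (simp add: Un_ac)
  also have "\<dots> = weight z r (A \<union> (\<Union>i\<in>I. R i)) * falling_factorial (z + of_nat r) (card (R j))"
  proof (rule weight_Un_clique[OF _ _ K(2,3)])
    show "\<not> E x y" if "x \<in> R j" "y \<in> A \<union> (\<Union>i\<in>I. R i)" for x y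
      using that disj insert.prems(3)[of j x y] by blast
  qed (use A K(1) insert.hyps insert.prems(2) disj in auto)
  also have "weight z r (A \<union> (\<Union>i\<in>I. R i)) =
      weight z r A * (\<Prod>i\<in>I. falling_factorial (z + of_nat r) (card (R i)))"
    by (rule insert.IH[OF disjoint_family_on_mono[OF subset_insertI insert.prems(1)]
          insert.prems(2,3)]) auto
  finally show ?case
    using insert.hyps by (simp add: mult_ac)
qed

section \<open>From weights to Stirling numbers\<close>

text \<open>Group the partitions by \<open>k = card P - r\<close>. The clique gives
  \<open>r \<le> card P\<close>, and nonempty blocks give
  \<open>card P \<le> card A = M + r\<close>, so \<open>k\<close> ranges over
  \<open>0..M\<close>.\<close>

lemma weight_eq_sum_card:
  assumes A: "finite A" and K: "K \<subseteq> A" "pairwise E K" "card K = r" and M: "card A = M + r"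
  shows "weight z r A =
    (\<Sum>k=0..M. of_nat (card {P \<in> independent_partitions A. card P = k + r}) * falling_factorial z k)"
proof -
  have "card P - r \<in> {0..M} \<and> r \<le> card P" if P: "P \<in> independent_partitions A" for P
  proof -
    note part = independent_partitionsD(1)[OF P]
    have "card P \<le> card A"
    proof -
      have finB: "finite B" if "B \<in> P" for B
        using that A partition_onD1[OF part] by (meson Union_upper finite_subset)
      have "card B \<ge> 1" if "B \<in> P" for B
        using that finB partition_onD3[OF part] by (metis One_nat_def Suc_leI card_gt_0_iff)
      then have "(\<Sum>B\<in>P. 1) \<le> (\<Sum>B\<in>P. card B)"
        by (rule sum_mono)
      then show ?thesis
        using product_partition[OF part finB] by simp
    qed
    then show ?thesis
      using M card_clique_le_card_partition[OF P K(1,2) A] K(3) by auto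
  qed note bound = this
  have "weight z r A = (\<Sum>k=0..M. \<Sum>P\<in>{P \<in> independent_partitions A. card P - r = k}.
      falling_factorial z (card P - r))"
    unfolding weight_def using bound finite_independent_partitions[OF A]
    by (intro sum.group[symmetric]) auto
  \<comment> \<open>Because \<open>r \<le> card P\<close>, the condition
    \<open>card P - r = k\<close> is the same as \<open>card P = k + r\<close>.\<close>
  also have "\<dots> = (\<Sum>k=0..M. \<Sum>P\<in>{P \<in> independent_partitions A. card P = k + r}.
      falling_factorial z k)"
    using bound by (intro sum.cong) fastforce+
  finally show ?thesis by simp
qed

end

text \<open>Computing the weight of \<open>{1..N}\<close> in two ways, vertex by vertex and by
  number of blocks, gives the two sides. The polynomial identity is the instance where
  \<open>z\<close> is the indeterminate.\<close>

lemma multi_stirling_expansion: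
  fixes z :: "'a::comm_ring_1"
  assumes p: "p \<ge> 1"
  shows "(\<Prod>i\<in>{1..<p}. falling_factorial (z + of_nat (r p)) (r i)) * (z + of_nat (r p)) ^ n =
    (\<Sum>k=0..n + (\<Sum>i\<in>{1..<p}. r i).
       of_nat (multi_stirling p r (n + (\<Sum>i\<in>{1..p}. r i)) (k + r p)) * falling_factorial z k)"
proof -
  define N where "N = n + (\<Sum>i\<in>{1..p}. r i)"
  define R where "R = consecutive_family r"
  \<comment> \<open>The graph is a disjoint union of cliques \<open>R i\<close> together with
    isolated vertices.\<close>
  define E where "E x y \<longleftrightarrow> x \<noteq> y \<and> (\<exists>i\<in>{1..p}. x \<in> R i \<and> y \<in> R i)" for x y
  interpret conflict_graph E
    by unfold_locales (auto simp: E_def)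
  have adm: "admissible_family N p r R"
    unfolding R_def by (rule admissible_consecutive_family) (simp add: N_def)
  then have RN: "R i \<subseteq> {1..N}" and cR: "card (R i) = r i" if "i \<in> {1..p}" for i
    using that by (auto simp: admissible_family_def)
  have fR: "finite (R i)" if "i \<in> {1..p}" for i
    using RN[OF that] by (rule finite_subset) simp
  have disj: "disjoint_family_on R {1..p}"
    using adm by (simp add: admissible_family_def)
  have eq: "i = j" if "i \<in> {1..p}" "j \<in> {1..p}" "x \<in> R i" "x \<in> R j" for i j x
    using disjoint_family_onD[OF disj that(1,2)] that(3,4) by blast
  have clique: "pairwise E (R i)" if "i \<in> {1..p}" for i
    using that by (auto simp: pairwise_def E_def)
  have pI: "p \<in> {1..p}" using p by simp
  have split: "{1..p} = insert p {1..<p}" using p by auto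
  \<comment> \<open>\<open>R p\<close> is kept apart: it is the starting clique of weight 1 and
    plays the part of \<open>K\<close> in every later extension.\<close>
  define U where "U = R p \<union> (\<Union>i\<in>{1..<p}. R i)"
  have U: "U = (\<Union>i\<in>{1..p}. R i)"
    unfolding U_def split by simp
  have finU: "finite U" and UN: "U \<subseteq> {1..N}"
    unfolding U using fR by (simp, intro UN_least RN)
  have cardU: "card U = (\<Sum>i\<in>{1..p}. r i)"
    unfolding U using fR cR disj
    by (subst card_UN_disjoint) (auto simp: disjoint_family_on_def)
  \<comment> \<open>The \<open>n\<close> elements outside all \<open>R i\<close> are the isolated
    vertices and produce the power.\<close>
  have cardD: "card ({1..N} - U) = n"
    using card_Diff_subset[OF finU UN] cardU by (simp add: N_def)
  have "weight z (r p) {1..N} = weight z (r p) (U \<union> ({1..N} - U))"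
    using UN by (simp add: Un_absorb1)
  also have "\<dots> = weight z (r p) U * (z + of_nat (r p)) ^ card ({1..N} - U)"
  proof (rule weight_Un_isolated[OF finU _ clique[OF pI] cR[OF pI]])
    show "\<not> E x y" if "x \<in> {1..N} - U" for x y
      using that unfolding E_def U by blast
  qed (auto simp: U_def)
  also have "weight z (r p) U = weight z (r p) (R p) *
      (\<Prod>i\<in>{1..<p}. falling_factorial (z + of_nat (r p)) (card (R i)))"
    unfolding U_def
  proof (rule weight_Un_cliques[OF fR[OF pI] order_refl clique[OF pI] cR[OF pI]])
    show "disjoint_family_on R {1..<p}"
      by (rule disjoint_family_on_mono[OF _ disj]) auto
    show "finite (R i) \<and> R i \<inter> R p = {} \<and> pairwise E (R i)" if "i \<in> {1..<p}" for i
      using that fR[of i] clique[of i] disjoint_family_onD[OF disj, of i p] by auto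
    show "\<not> E x y" if "i \<in> {1..<p}" "x \<in> R i" "y \<notin> R i" for i x y
      using that eq[of i _ x] unfolding E_def by fastforce
  qed simp
  also have "weight z (r p) (R p) = 1"
    using weight_clique[OF fR[OF pI] clique[OF pI], of z] cR[OF pI] by simp
  also have "(\<Prod>i\<in>{1..<p}. falling_factorial (z + of_nat (r p)) (card (R i))) =
      (\<Prod>i\<in>{1..<p}. falling_factorial (z + of_nat (r p)) (r i))"
    using cR by (intro prod.cong) auto
  finally have L: "weight z (r p) {1..N} =
      (\<Prod>i\<in>{1..<p}. falling_factorial (z + of_nat (r p)) (r i)) * (z + of_nat (r p)) ^ n"
    by (simp only: cardD mult_1)
  \<comment> \<open>A block is independent precisely when it contains no two distinct elements of
    any one \<open>R i\<close>.\<close>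
  have sep: "separating_partitions N k p R = {P \<in> independent_partitions {1..N}. card P = k}" for k
    unfolding separating_partitions_def independent_partitions_def E_def by blast
  \<comment> \<open>Taking \<open>r p\<close> out of \<open>N\<close> leaves the upper summation
    limit.\<close>
  have "card {1..N} = n + (\<Sum>i\<in>{1..<p}. r i) + r p"
    unfolding N_def split by simp
  then have "weight z (r p) {1..N} = (\<Sum>k=0..n + (\<Sum>i\<in>{1..<p}. r i).
      of_nat (card (separating_partitions N (k + r p) p R)) * falling_factorial z k)"
    unfolding sep
    by (intro weight_eq_sum_card[OF _ RN[OF pI] clique[OF pI] cR[OF pI]]) simp_all
  then show ?thesis
    unfolding L[symmetric] N_def[symmetric] multi_stirling_eq_card[OF adm] .
qed

theorem theorem5:
  fixes p n :: nat and r :: "nat \<Rightarrow> nat" and z :: "'a::comm_ring_1 poly"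
  assumes "p \<ge> 1"
    and "\<And>i j. 1 \<le> i \<Longrightarrow> i \<le> j \<Longrightarrow> j \<le> p \<Longrightarrow> r i \<le> r j"
    and "z = [:0, 1:]"
  shows "(\<Prod>i\<in>{1..<p}. falling_factorial (z + of_nat (r p)) (r i)) * (z + of_nat (r p)) ^ n =
           (\<Sum>k=0..n + (\<Sum>i\<in>{1..<p}. r i).
              of_nat (multi_stirling p r (n + (\<Sum>i\<in>{1..p}. r i)) (k + r p)) * falling_factorial z k) \<and>
         (\<forall>s::nat. (z + of_nat s) ^ n =
           (\<Sum>k=0..n. of_nat (r_stirling s (n + s) (k + s)) * falling_factorial z k))"
proof (intro conjI allI)
  \<comment> \<open>For \<open>p = 1\<close> the product and the sum over \<open>{1..<p}\<close> are
    empty, and only the power remains.\<close>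
  show "(z + of_nat s) ^ n =
      (\<Sum>k=0..n. of_nat (r_stirling s (n + s) (k + s)) * falling_factorial z k)" for s
    using multi_stirling_expansion[of 1 z "\<lambda>_. s" n] by simp
qed (rule multi_stirling_expansion[OF assms(1)])

end
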